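(* Let $X$ and $Y$ be real Banach spaces with preduals $X_*$ and $Y_*$, where $X_*$ is separable or reflexive. Let $K\colon X\to Y$ be a bounded dilinear mapping, $R\colon X\to\overline{\mathbb R}$ a non-negative, proper, diconvex functional, and $p\ge1$. For $\alpha>0$ and data $g^\delta\in Y$ consider the Tikhonov functional $$J_\alpha(u):=\|K(u)-g^\delta\|^p+\alpha R(u)\qquad(u\in X).$$ Assume that (i) $J_\alpha(u)\to+\infty$ whenever $\|u\|\to+\infty$; (ii) $R$ is sequentially weakly$*$ lower semi-continuous; (iii) $K$ is sequentially weakly$*$ continuous. Let $g^\dagger\in Y$ be the exact (noise-free) data of the inverse problem $K(u)=g^\dagger$, and let $(g^{\delta_n})_{n\in\mathbb N}$ be a sequence of noisy data in $Y$ with $\delta_n:=\|g^\dagger-g^{\delta_n}\|\to0$. Let the regularization parameters $\alpha_n=\alpha(\delta_n)>0$ satisfy $$\lim_{n\to\infty}\frac{\delta_n^p}{\alpha_n}=0\qquad\text{and}\qquad\lim_{n\to\infty}\alpha_n=0,$$ and let $u_{\alpha_n}^{\delta_n}$ be a minimizer of $u\mapsto\|K(u)-g^{\delta_n}\|^p+\alpha_nR(u)$ over $X$. Then: (a) The sequence of minimizers $(u_{\alpha_n}^{\delta_n})_{n\in\mathbb N}$ contains a weakly$*$ convergent subsequence whose limit is an $R$-minimizing solution $u^\dagger$ of $K(u)=g^\dagger$. (b) If the $R$-minimizing solution $u^\dagger$ is unique, then the entire sequence $(u_{\alpha_n}^{\delta_n})_{n\in\mathbb N}$ converges weakly$*$.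 (c) If the functional $R$ possesses the H-property on $X$, then the sequence $(u_{\alpha_n}^{\delta_n})_{n\in\mathbb N}$ converges in norm topology.
   Context: $\overline{\mathbb R}=\mathbb R\cup\{\pm\infty\}$; a functional is proper if it is never $-\infty$ and not identically $+\infty$. For a real Banach space $X$, $X\otimes_\pi X$ is the (completed) projective tensor product and $X\otimes_{\pi,\mathrm{sym}}X$ is its closed subspace spanned by the tensors $u\otimes u$, $u\in X$. A mapping $K\colon X\to Y$ is dilinear if there is a linear $\breve K\colon X\times(X\otimes_{\pi,\mathrm{sym}}X)\to Y$ with $K(u)=\breve K(u,u\otimes u)$ for all $u\in X$; it is bounded if $\breve K$ is bounded. A mapping $F\colon X\to\overline{\mathbb R}$ is diconvex if there is a proper, convex $\breve F\colon X\times(X\otimes_{\pi,\mathrm{sym}}X)\to\overline{\mathbb R}$ with $F(u)=\breve F(u,u\otimes u)$ for all $u\in X$. Weak$*$ topologies on $X$ and $Y$ are those induced by the preduals $X_*$ and $Y_*$. A point $u^\dagger\in X$ is an $R$-minimizing solution of $K(u)=g^\dagger$ if $K(u^\dagger)=g^\dagger$ and $R(u^\dagger)\le R(u)$ for all further solutions $u$ of $K(u)=g^\dagger$. A functional $R\colon X\to\overline{\mathbb R}$ has the H-property on $X$ if any weakly$*$ convergent sequence $(u_n)$ in $X$ with limit $u$ and with $R(u_n)\to R(u)$ converges to $u$ strongly (in norm).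
   Formalization: Assumes K(u)=g† has a solution with finite R, since (a) can fail otherwise; (c), false without uniqueness, is read as: every weakly* convergent subsequence converges in norm, and the entire sequence does if the R-minimizing solution is unique. *)

theory Defs
  imports "HOL-Analysis.Analysis"
begin

section \<open>A Hahn-Banach lemma\<close>

definition sublinear :: "('v::real_vector \<Rightarrow> real) \<Rightarrow> bool" where
  "sublinear q \<longleftrightarrow> (\<forall>x y. q (x + y) \<le> q x + q y) \<and> (\<forall>x. \<forall>c\<ge>0. q (c *\<^sub>R x) = c * q x)"

lemma sublinearD:
  assumes "sublinear q"
  shows "q (x + y) \<le> q x + q y" "c \<ge> 0 \<Longrightarrow> q (c *\<^sub>R x) = c * q x" "q 0 = 0" "- q (- x) \<le> q x"
proof -
  show "q (x + y) \<le> q x + q y" and "c \<ge> 0 \<Longrightarrow> q (c *\<^sub>R x) = c * q x"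
    using assms by (auto simp: sublinear_def)
  have "q (0 *\<^sub>R 0) = 0 * q 0" using assms unfolding sublinear_def by blast
  then show z: "q 0 = 0" by simp
  have "q (x + - x) \<le> q x + q (- x)" using assms unfolding sublinear_def by blast
  then show "- q (- x) \<le> q x" using z by simp
qed

lemma sublinear_minorant:
  fixes p :: "'v::real_vector \<Rightarrow> real"
  assumes p: "sublinear p"
  obtains q where "sublinear q" "\<And>x. q x \<le> p x" "q (- y) \<le> - p y"
proof -
  define q where "q = (\<lambda>x. INF t\<in>{0..}. p (x + t *\<^sub>R y) - t * p y)"
  have lower: "- p (- x) \<le> p (x + t *\<^sub>R y) - t * p y" if "t \<ge> 0" for x t
    using sublinearD(1)[OF p, of "x + t *\<^sub>R y" "- x"] sublinearD(2)[OF p that, of y] by simp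
  have bdd: "bdd_below ((\<lambda>t. p (x + t *\<^sub>R y) - t * p y) ` {0..})" for x
    by (rule bdd_belowI2[where m = "- p (- x)"]) (use lower in auto)
  have q_le: "q x \<le> p (x + t *\<^sub>R y) - t * p y" if "t \<ge> 0" for x t
    unfolding q_def by (rule cINF_lower[OF bdd]) (use that in auto)
  have q_ge: "m \<le> q x" if "\<And>t. t \<ge> 0 \<Longrightarrow> m \<le> p (x + t *\<^sub>R y) - t * p y" for m x
    unfolding q_def by (rule cINF_greatest) (use that in auto)
  have add: "q (a + b) \<le> q a + q b" for a b
  proof -
    have 1: "q (a + b) \<le> (p (a + s *\<^sub>R y) - s * p y) + (p (b + t *\<^sub>R y) - t * p y)"
      if "s \<ge> 0" "t \<ge> 0" for s t
    proof -
      have "q (a + b) \<le> p (a + b + (s + t) *\<^sub>R y) - (s + t) * p y"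
        using that by (intro q_le) simp
      also have "a + b + (s + t) *\<^sub>R y = (a + s *\<^sub>R y) + (b + t *\<^sub>R y)"
        by (simp add: algebra_simps)
      also have "p \<dots> \<le> p (a + s *\<^sub>R y) + p (b + t *\<^sub>R y)" by (rule sublinearD(1)[OF p])
      finally show ?thesis by (simp add: algebra_simps)
    qed
    have "q (a + b) - (p (a + s *\<^sub>R y) - s * p y) \<le> q b" if "s \<ge> 0" for s
      using 1[OF that] by (intro q_ge) (simp add: algebra_simps)
    then have "q (a + b) - q b \<le> q a"
      by (intro q_ge) (simp add: algebra_simps)
    then show ?thesis by simp
  qed
  have hom_le: "q (c *\<^sub>R x) \<le> c * q x" if "c > 0" for c x
  proof -
    have "q (c *\<^sub>R x) / c \<le> q x"
    proof (rule q_ge)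
      fix t :: real assume t: "t \<ge> 0"
      have "q (c *\<^sub>R x) \<le> p (c *\<^sub>R x + (c * t) *\<^sub>R y) - (c * t) * p y"
        using that t by (intro q_le) simp
      also have "c *\<^sub>R x + (c * t) *\<^sub>R y = c *\<^sub>R (x + t *\<^sub>R y)" by (simp add: algebra_simps)
      also have "p \<dots> = c * p (x + t *\<^sub>R y)" using that by (intro sublinearD(2)[OF p]) simp
      finally show "q (c *\<^sub>R x) / c \<le> p (x + t *\<^sub>R y) - t * p y"
        using that by (simp add: field_simps)
    qed
    then show ?thesis using that by (simp add: field_simps)
  qed
  have zero: "q 0 = 0"
  proof -
    have "p (0 + t *\<^sub>R y) - t * p y = 0" if "t \<ge> 0" for t
      using sublinearD(2)[OF p that] by simp
    then show ?thesis using q_le[of 0 0] q_ge[of 0 0] by fastforce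
  qed
  have hom: "q (c *\<^sub>R x) = c * q x" if "c \<ge> 0" for c x
  proof (cases "c = 0")
    case False
    then have c: "c > 0" using that by simp
    have "q (inverse c *\<^sub>R c *\<^sub>R x) \<le> inverse c * q (c *\<^sub>R x)" using c by (intro hom_le) simp
    then have "q x \<le> inverse c * q (c *\<^sub>R x)" using c by simp
    then have "c * q x \<le> q (c *\<^sub>R x)" using c by (simp add: field_simps)
    then show ?thesis using hom_le[OF c, of x] by simp
  qed (use zero in simp)
  have "sublinear q" using add hom by (simp add: sublinear_def)
  moreover have "q x \<le> p x" for x using q_le[of 0 x] by simp
  moreover have "q (- y) \<le> - p y" using q_le[of 1 "- y"] sublinearD(3)[OF p] by simp
  ultimately show ?thesis by (rule that)
qed

lemma sublinear_dominates_linear: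
  fixes p :: "'v::real_vector \<Rightarrow> real"
  assumes p: "sublinear p"
  obtains f where "linear f" "\<And>x. f x \<le> p x" "f y = p y"
proof -
  obtain p' where p': "sublinear p'" "\<And>x. p' x \<le> p x" "p' (- y) \<le> - p y"
    using sublinear_minorant[OF p] by blast
  define A where "A = {q. sublinear q \<and> (\<forall>x. q x \<le> p' x)}"
  define P :: "('v \<Rightarrow> real) \<Rightarrow> ('v \<Rightarrow> real) \<Rightarrow> bool" where "P = (\<lambda>a b. b \<le> a)"
  have po: "partial_order_on A (relation_of P A)"
    unfolding P_def by (rule partial_order_on_relation_ofI) auto
  have "\<exists>m\<in>A. \<forall>a\<in>A. P m a \<longrightarrow> a = m"
  proof (rule predicate_Zorn[OF po])
    fix C assume C: "C \<in> Chains (relation_of P A)"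
    then have CA: "C \<subseteq> A" and tot: "\<And>a b. a \<in> C \<Longrightarrow> b \<in> C \<Longrightarrow> a \<le> b \<or> b \<le> a"
      by (auto simp: Chains_def relation_of_def P_def)
    show "\<exists>u\<in>A. \<forall>a\<in>C. P a u"
    proof (cases "C = {}")
      case True
      then show ?thesis using p'(1) by (auto simp: A_def)
    next
      case False
      define u where "u = (\<lambda>x. INF q\<in>C. q x)"
      have bdd: "bdd_below ((\<lambda>q. q x) ` C)" for x
      proof (rule bdd_belowI2)
        fix q assume "q \<in> C"
        then have "sublinear q" "q (- x) \<le> p' (- x)" using CA by (auto simp: A_def)
        then show "- p' (- x) \<le> q x" using sublinearD(4)[of q x] by simp
      qed
      have u_le: "u x \<le> q x" if "q \<in> C" for q x
        unfolding u_def using that by (intro cINF_lower[OF bdd])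
      have u_ge: "m \<le> u x" if "\<And>q. q \<in> C \<Longrightarrow> m \<le> q x" for m x
        unfolding u_def using False that by (intro cINF_greatest)
      have sl: "sublinear q" if "q \<in> C" for q using that CA by (auto simp: A_def)
      have "u (a + b) \<le> u a + u b" for a b
      proof -
        have 1: "u (a + b) \<le> q a + r b" if "q \<in> C" "r \<in> C" for q r
        proof -
          from tot[OF that] show ?thesis
          proof
            assume "q \<le> r"
            then show ?thesis
              using u_le[OF that(1), of "a + b"] sublinearD(1)[OF sl[OF that(1)], of a b]
              by (auto dest: le_funD[of _ _ b])
          next
            assume "r \<le> q"
            then show ?thesis
              using u_le[OF that(2), of "a + b"] sublinearD(1)[OF sl[OF that(2)], of a b]
              by (auto dest: le_funD[of _ _ a])
          qed
        qed
        have "u (a + b) - q a \<le> u b" if "q \<in> C" for q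
          using 1[OF that] by (intro u_ge) (simp add: algebra_simps)
        then have "u (a + b) - u b \<le> u a" by (intro u_ge) (simp add: algebra_simps)
        then show ?thesis by simp
      qed
      moreover have "u (c *\<^sub>R x) = c * u x" if "c \<ge> 0" for c x
      proof (cases "c = 0")
        case True
        have "u 0 = 0"
          using False u_le[of _ 0] u_ge[of 0 0] sublinearD(3)[OF sl] by fastforce
        then show ?thesis using True by simp
      next
        case nz: False
        then have c: "c > 0" using that by simp
        have "u (c *\<^sub>R x) / c \<le> u x"
        proof (rule u_ge)
          fix q assume "q \<in> C"
          then have "u (c *\<^sub>R x) \<le> c * q x" using u_le[of q "c *\<^sub>R x"] sublinearD(2)[OF sl that] by simp
          then show "u (c *\<^sub>R x) / c \<le> q x" using c by (simp add: field_simps)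
        qed
        moreover have "c * u x \<le> u (c *\<^sub>R x)"
        proof (rule u_ge)
          fix q assume q: "q \<in> C"
          then show "c * u x \<le> q (c *\<^sub>R x)"
            using u_le[OF q, of x] sublinearD(2)[OF sl[OF q] that, of x] c by simp
        qed
        ultimately show ?thesis using c by (simp add: field_simps)
      qed
      ultimately have "sublinear u" by (simp add: sublinear_def)
      moreover have "u x \<le> p' x" for x
      proof -
        obtain q where "q \<in> C" using False by blast
        moreover from this have "q x \<le> p' x" using CA by (auto simp: A_def)
        ultimately show ?thesis using u_le[of q x] by simp
      qed
      ultimately have "u \<in> A" by (simp add: A_def)
      moreover have "\<forall>a\<in>C. P a u" using u_le by (auto simp: P_def le_fun_def)
      ultimately show ?thesis by blast
    qed
  qed
  then obtain f where f: "sublinear f" "\<And>x. f x \<le> p' x"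
    and fmin: "\<And>q. sublinear q \<Longrightarrow> (\<And>x. q x \<le> p' x) \<Longrightarrow> (\<And>x. q x \<le> f x) \<Longrightarrow> q = f"
  proof -
    assume *: "\<And>f. sublinear f \<Longrightarrow> (\<And>x. f x \<le> p' x) \<Longrightarrow>
      (\<And>q. sublinear q \<Longrightarrow> (\<And>x. q x \<le> p' x) \<Longrightarrow> (\<And>x. q x \<le> f x) \<Longrightarrow> q = f) \<Longrightarrow> thesis"
    assume "\<exists>m\<in>A. \<forall>a\<in>A. P m a \<longrightarrow> a = m"
    then obtain f where "f \<in> A" "\<forall>a\<in>A. P f a \<longrightarrow> a = f" by blast
    then show thesis by (intro *[of f]) (auto simp: A_def P_def le_fun_def)
  qed
  have neg: "f (- x) = - f x" for x
  proof -
    obtain q where q: "sublinear q" "\<And>z. q z \<le> f z" "q (- x) \<le> - f x"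
      using sublinear_minorant[OF f(1)] by blast
    have "q = f" using q(2) f(2) by (intro fmin q) (blast intro: order_trans)
    then show ?thesis using q(3) sublinearD(4)[OF f(1), of x] by simp
  qed
  have "linear f"
  proof (rule linearI)
    fix a b
    have "f (- a + - b) \<le> f (- a) + f (- b)" by (rule sublinearD(1)[OF f(1)])
    moreover have "f (- a + - b) = - f (a + b)" using neg[of "a + b"] by simp
    ultimately show "f (a + b) = f a + f b"
      using sublinearD(1)[OF f(1), of a b] neg by simp
  next
    fix c x
    show "f (c *\<^sub>R x) = c *\<^sub>R f x"
    proof (cases "c \<ge> 0")
      case True
      then show ?thesis using sublinearD(2)[OF f(1)] by simp
    next
      case False
      then have "f (- c *\<^sub>R x) = - c * f x" using sublinearD(2)[OF f(1), of "- c" x] by simp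
      then show ?thesis using neg[of "c *\<^sub>R x"] by simp
    qed
  qed
  moreover have "f x \<le> p x" for x using f(2) p'(2) by (rule order_trans)
  moreover have "f y = p y" using f(2)[of "- y"] p'(3) neg[of y] f(2)[of y] p'(2)[of y] by simp
  ultimately show ?thesis by (rule that)
qed


section \<open>Projective and symmetric projective tensor products\<close>

text \<open>
  Elementary tensors are realised as functionals on bounded bilinear forms,
  \<open>(u \<otimes> v)(B) = B(u, v)\<close>; bounded bilinear forms separate the points of the algebraic tensor
  product, so nothing is identified by restricting to bounded forms. The algebraic tensor product is their span, and its completion with
  respect to the projective norm is the closure of that span in the dual of the space of bounded
  bilinear forms. The lemma \<open>norm_eq_proj_norm\<close> below shows that the dual norm coincides on the
  algebraic tensor product with the infimum that defines the projective norm.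
\<close>

type_synonym ('a, 'b) bilform_dual = "('a \<Rightarrow>\<^sub>L 'b \<Rightarrow>\<^sub>L real) \<Rightarrow>\<^sub>L real"

definition tensor :: "'a::real_normed_vector \<Rightarrow> 'b::real_normed_vector \<Rightarrow> ('a, 'b) bilform_dual"
  (infixl "\<otimes>\<^sub>\<pi>" 75) where
  "u \<otimes>\<^sub>\<pi> v = Blinfun (\<lambda>B. blinfun_apply (blinfun_apply B u) v)"

definition alg_tensor_product :: "('a::real_normed_vector, 'b::real_normed_vector) bilform_dual set"
  where "alg_tensor_product = span {u \<otimes>\<^sub>\<pi> v | u v. True}"

definition proj_tensor_product :: "('a::real_normed_vector, 'b::real_normed_vector) bilform_dual set"
  where "proj_tensor_product = closure alg_tensor_product"

definition sym_proj_tensor_product :: "('a::real_normed_vector, 'a) bilform_dual set"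
  where "sym_proj_tensor_product = closure (span {u \<otimes>\<^sub>\<pi> u | u. True})"

definition tensor_costs :: "('a::real_normed_vector, 'b::real_normed_vector) bilform_dual \<Rightarrow> real set"
  where "tensor_costs w =
    {\<Sum>k<n. norm (u k) * norm (v k) | (n::nat) u v. w = (\<Sum>k<n. u k \<otimes>\<^sub>\<pi> v k)}"

definition proj_norm :: "('a::real_normed_vector, 'b::real_normed_vector) bilform_dual \<Rightarrow> real"
  where "proj_norm w = Inf (tensor_costs w)"

lemma tensor_apply: "blinfun_apply (u \<otimes>\<^sub>\<pi> v) B = blinfun_apply (blinfun_apply B u) v"
proof -
  have "bounded_linear (\<lambda>B :: 'a \<Rightarrow>\<^sub>L 'b \<Rightarrow>\<^sub>L real. blinfun_apply (blinfun_apply B u) v)"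
    by (intro bounded_linear_intros)
  then show ?thesis by (simp add: tensor_def bounded_linear_Blinfun_apply)
qed

lemma tensor_add_left: "(u + u') \<otimes>\<^sub>\<pi> v = u \<otimes>\<^sub>\<pi> v + u' \<otimes>\<^sub>\<pi> v"
  and tensor_add_right: "u \<otimes>\<^sub>\<pi> (v + v') = u \<otimes>\<^sub>\<pi> v + u \<otimes>\<^sub>\<pi> v'"
  and tensor_scaleR_left: "(c *\<^sub>R u) \<otimes>\<^sub>\<pi> v = c *\<^sub>R (u \<otimes>\<^sub>\<pi> v)"
  and tensor_scaleR_right: "u \<otimes>\<^sub>\<pi> (c *\<^sub>R v) = c *\<^sub>R (u \<otimes>\<^sub>\<pi> v)"
  by (auto intro!: blinfun_eqI
      simp: tensor_apply blinfun.add_left blinfun.add_right blinfun.scaleR_left blinfun.scaleR_right)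

lemma norm_tensor_le: "norm (u \<otimes>\<^sub>\<pi> v) \<le> norm u * norm v"
proof (rule norm_blinfun_bound)
  fix B :: "'a \<Rightarrow>\<^sub>L 'b \<Rightarrow>\<^sub>L real"
  have "norm (blinfun_apply (blinfun_apply B u) v) \<le> norm (blinfun_apply B u) * norm v"
    by (rule norm_blinfun)
  also have "\<dots> \<le> (norm B * norm u) * norm v"
    by (intro mult_right_mono norm_blinfun) simp
  finally show "norm (blinfun_apply (u \<otimes>\<^sub>\<pi> v) B) \<le> norm u * norm v * norm B"
    by (simp add: tensor_apply mult_ac)
qed simp

lemma norm_le_tensor_costs: "c \<in> tensor_costs w \<Longrightarrow> norm w \<le> c"
  unfolding tensor_costs_def by (auto intro!: sum_norm_le norm_tensor_le)

lemma tensor_costs_tensor: "norm u * norm v \<in> tensor_costs (u \<otimes>\<^sub>\<pi> v)"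
  unfolding tensor_costs_def by (rule CollectI, rule exI[of _ 1], rule exI[of _ "\<lambda>_. u"],
      rule exI[of _ "\<lambda>_. v"]) simp

lemma tensor_costs_0: "0 \<in> tensor_costs 0"
  unfolding tensor_costs_def by (rule CollectI, rule exI[of _ 0]) simp

lemma tensor_costs_scaleR:
  assumes "c \<in> tensor_costs w"
  shows "\<bar>r\<bar> * c \<in> tensor_costs (r *\<^sub>R w)"
proof -
  obtain n :: nat and u v where "w = (\<Sum>k<n. u k \<otimes>\<^sub>\<pi> v k)" "c = (\<Sum>k<n. norm (u k) * norm (v k))"
    using assms unfolding tensor_costs_def by blast
  then show ?thesis unfolding tensor_costs_def
    by (intro CollectI exI[of _ n] exI[of _ "\<lambda>k. r *\<^sub>R u k"] exI[of _ v])
       (simp add: scaleR_sum_right sum_distrib_left tensor_scaleR_left mult.assoc)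
qed

lemma tensor_costs_add:
  assumes "c \<in> tensor_costs w" "d \<in> tensor_costs z"
  shows "c + d \<in> tensor_costs (w + z)"
proof -
  obtain n :: nat and u v where w: "w = (\<Sum>k<n. u k \<otimes>\<^sub>\<pi> v k)" "c = (\<Sum>k<n. norm (u k) * norm (v k))"
    using assms unfolding tensor_costs_def by blast
  obtain m :: nat and u' v' where z: "z = (\<Sum>k<m. u' k \<otimes>\<^sub>\<pi> v' k)" "d = (\<Sum>k<m. norm (u' k) * norm (v' k))"
    using assms unfolding tensor_costs_def by blast
  have split: "(\<Sum>k<n + m. h k) = (\<Sum>k<n. h k) + (\<Sum>k<m. h (n + k))"
    for h :: "nat \<Rightarrow> 'x::comm_monoid_add"
    by (induction m) (auto simp: add.assoc)
  show ?thesis unfolding tensor_costs_def w z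
    by (intro CollectI exI[of _ "n + m"] exI[of _ "\<lambda>k. if k < n then u k else u' (k - n)"]
        exI[of _ "\<lambda>k. if k < n then v k else v' (k - n)"]) (simp add: split split: if_splits)
qed

lemma tensor_costs_nonempty:
  assumes "w \<in> alg_tensor_product"
  shows "tensor_costs w \<noteq> {}"
  using assms unfolding alg_tensor_product_def
proof (induction rule: span_induct_alt)
  case base
  then show ?case using tensor_costs_0 by blast
next
  case (step c x y)
  then show ?case using tensor_costs_add tensor_costs_scaleR tensor_costs_tensor by blast
qed

lemma norm_eq_proj_norm:
  assumes "w \<in> alg_tensor_product"
  shows "norm w = proj_norm w"
proof (rule antisym)
  show "norm w \<le> proj_norm w"
    unfolding proj_norm_def
    by (rule cInf_greatest) (use tensor_costs_nonempty[OF assms] norm_le_tensor_costs in auto)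
  let ?V = "alg_tensor_product :: ('a, 'b) bilform_dual set"
  have sub: "subspace ?V" unfolding alg_tensor_product_def by (rule subspace_span)
  have bdd: "bdd_below (tensor_costs z)" for z :: "('a, 'b) bilform_dual"
    using norm_le_tensor_costs by (rule bdd_belowI)
  have le: "proj_norm z \<le> c" if "c \<in> tensor_costs z" for c and z :: "('a, 'b) bilform_dual"
    unfolding proj_norm_def by (rule cInf_lower[OF that bdd])
  have ge: "m \<le> proj_norm z" if "z \<in> ?V" "\<And>c. c \<in> tensor_costs z \<Longrightarrow> m \<le> c" for m z
    unfolding proj_norm_def by (rule cInf_greatest) (use that tensor_costs_nonempty in auto)
  obtain Q where Q: "linear Q" "range Q \<subseteq> ?V" "\<And>z. z \<in> ?V \<Longrightarrow> Q z = z"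
    using linear_exists_left_inverse_on[OF linear_id sub] by auto
  have QV: "Q z \<in> ?V" for z using Q(2) by blast
  have "sublinear (\<lambda>z. proj_norm (Q z))"
    unfolding sublinear_def
  proof (intro conjI allI impI)
    fix x y
    have sum_le: "proj_norm (Q x + Q y) \<le> c + d"
      if "c \<in> tensor_costs (Q x)" "d \<in> tensor_costs (Q y)" for c d
      using le[OF tensor_costs_add[OF that]] .
    have "proj_norm (Q x + Q y) - c \<le> proj_norm (Q y)" if "c \<in> tensor_costs (Q x)" for c
      using sum_le[OF that] by (intro ge QV) (simp add: diff_le_eq add.commute)
    then have "proj_norm (Q x + Q y) - proj_norm (Q y) \<le> proj_norm (Q x)"
      by (intro ge QV) (simp add: algebra_simps)
    then show "proj_norm (Q (x + y)) \<le> proj_norm (Q x) + proj_norm (Q y)"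
      using linear_add[OF Q(1)] by simp
  next
    fix x and c :: real assume c: "c \<ge> 0"
    have hom_le: "proj_norm (r *\<^sub>R z) \<le> r * proj_norm z" if "r > 0" "z \<in> ?V" for r z
    proof -
      have "proj_norm (r *\<^sub>R z) / r \<le> proj_norm z"
      proof (rule ge[OF that(2)])
        fix d assume "d \<in> tensor_costs z"
        from le[OF tensor_costs_scaleR[OF this, of r]]
        show "proj_norm (r *\<^sub>R z) / r \<le> d" using that by (simp add: field_simps)
      qed
      then show ?thesis using that by (simp add: field_simps)
    qed
    show "proj_norm (Q (c *\<^sub>R x)) = c * proj_norm (Q x)"
    proof (cases "c = 0")
      case True
      have "(0::('a, 'b) bilform_dual) \<in> ?V" by (rule subspace_0[OF sub])
      then have "0 \<le> proj_norm (0::('a, 'b) bilform_dual)"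
        using norm_le_tensor_costs by (intro ge) force+
      then show ?thesis using True le[OF tensor_costs_0] linear_0[OF Q(1)] by simp
    next
      case False
      then have c': "c > 0" using c by simp
      have "proj_norm (inverse c *\<^sub>R c *\<^sub>R Q x) \<le> inverse c * proj_norm (c *\<^sub>R Q x)"
        using c' by (intro hom_le subspace_scale[OF sub] QV) simp
      then have "c * proj_norm (Q x) \<le> proj_norm (c *\<^sub>R Q x)" using c' by (simp add: field_simps)
      then show ?thesis using hom_le[OF c' QV, of x] linear_scale[OF Q(1)] by simp
    qed
  qed
  then obtain f where f: "linear f" "\<And>z. f z \<le> proj_norm (Q z)" "f w = proj_norm (Q w)"
    using sublinear_dominates_linear[of _ w] by metis
  have tV: "u \<otimes>\<^sub>\<pi> v \<in> ?V" for u v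
    unfolding alg_tensor_product_def by (rule span_base) blast
  have f_le: "f (u \<otimes>\<^sub>\<pi> v) \<le> norm u * norm v" for u v
    using f(2)[of "u \<otimes>\<^sub>\<pi> v"] le[OF tensor_costs_tensor[of u v]] Q(3)[OF tV] by simp
  have abs_f: "\<bar>f (u \<otimes>\<^sub>\<pi> v)\<bar> \<le> norm u * norm v" for u v
  proof -
    have "(- u) \<otimes>\<^sub>\<pi> v = - (u \<otimes>\<^sub>\<pi> v)" using tensor_scaleR_left[of "-1" u v] by simp
    then show ?thesis using f_le[of u v] f_le[of "- u" v] linear_neg[OF f(1)] by simp
  qed
  have bl: "bounded_bilinear (\<lambda>u v. f (u \<otimes>\<^sub>\<pi> v))"
  proof
    show "\<exists>K. \<forall>u v. norm (f (u \<otimes>\<^sub>\<pi> v)) \<le> norm u * norm v * K"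
      using abs_f by (intro exI[of _ 1]) simp
  qed (simp_all add: tensor_add_left tensor_add_right tensor_scaleR_left tensor_scaleR_right
      linear_add[OF f(1)] linear_scale[OF f(1)])
  define B where "B = Blinfun (\<lambda>u. Blinfun (\<lambda>v. f (u \<otimes>\<^sub>\<pi> v)))"
  have Bu: "blinfun_apply (Blinfun (\<lambda>v. f (u \<otimes>\<^sub>\<pi> v))) v = f (u \<otimes>\<^sub>\<pi> v)" for u v
    using bounded_bilinear.bounded_linear_right[OF bl] by (simp add: bounded_linear_Blinfun_apply)
  have "bounded_linear (\<lambda>u. Blinfun (\<lambda>v. f (u \<otimes>\<^sub>\<pi> v)))"
  proof (rule bounded_linear_intro[where K = 1])
    show "norm (Blinfun (\<lambda>v. f (u \<otimes>\<^sub>\<pi> v))) \<le> norm u * 1" for u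
      using abs_f by (intro norm_blinfun_bound) (auto simp: Bu)
    show "Blinfun (\<lambda>v. f ((u + u') \<otimes>\<^sub>\<pi> v)) =
        Blinfun (\<lambda>v. f (u \<otimes>\<^sub>\<pi> v)) + Blinfun (\<lambda>v. f (u' \<otimes>\<^sub>\<pi> v))" for u u'
      by (rule blinfun_eqI, simp only: blinfun.add_left Bu)
         (simp only: tensor_add_left linear_add[OF f(1)])
    show "Blinfun (\<lambda>v. f ((r *\<^sub>R u) \<otimes>\<^sub>\<pi> v)) = r *\<^sub>R Blinfun (\<lambda>v. f (u \<otimes>\<^sub>\<pi> v))" for r u
      by (rule blinfun_eqI, simp only: blinfun.scaleR_left Bu)
         (simp only: tensor_scaleR_left linear_scale[OF f(1)])
  qed
  then have B: "blinfun_apply (blinfun_apply B u) v = f (u \<otimes>\<^sub>\<pi> v)" for u v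
    by (simp add: B_def bounded_linear_Blinfun_apply Bu)
  have "norm B \<le> 1"
  proof (rule norm_blinfun_bound)
    show "norm (blinfun_apply B u) \<le> 1 * norm u" for u
      using abs_f by (intro norm_blinfun_bound) (auto simp: B)
  qed simp
  obtain c where "c \<in> tensor_costs w" using tensor_costs_nonempty[OF assms] by blast
  then obtain n :: nat and u v where w: "w = (\<Sum>k<n. u k \<otimes>\<^sub>\<pi> v k)" by (auto simp: tensor_costs_def)
  have "proj_norm w = f w" using f(3) Q(3)[OF assms] by simp
  also have "\<dots> = blinfun_apply w B"
    by (simp add: w linear_sum[OF f(1)] blinfun.sum_left tensor_apply B)
  also have "\<dots> \<le> norm w * norm B" using norm_blinfun[of w B] by simp
  also have "\<dots> \<le> norm w * 1" using \<open>norm B \<le> 1\<close> by (intro mult_left_mono) auto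
  finally show "proj_norm w \<le> norm w" by simp
qed

lemma sym_proj_tensor_product_subset: "sym_proj_tensor_product \<subseteq> proj_tensor_product"
  unfolding sym_proj_tensor_product_def proj_tensor_product_def alg_tensor_product_def
  by (intro closure_mono span_mono) blast

lemma subspace_sym_proj_tensor_product: "subspace sym_proj_tensor_product"
proof -
  have "subspace (closure V)" if V: "subspace V" for V :: "('a, 'a) bilform_dual set"
    unfolding subspace_def
  proof (intro conjI ballI allI)
    show "0 \<in> closure V" using subspace_0[OF V] closure_subset by blast
  next
    fix x y assume "x \<in> closure V" "y \<in> closure V"
    then obtain f g where "\<And>n. f n \<in> V" "f \<longlonglongrightarrow> x" "\<And>n. g n \<in> V" "g \<longlonglongrightarrow> y"
      unfolding closure_sequential by blast
    then show "x + y \<in> closure V"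
      unfolding closure_sequential
      by (intro exI[of _ "\<lambda>n. f n + g n"] conjI allI subspace_add[OF V] tendsto_add)
  next
    fix c :: real and x assume "x \<in> closure V"
    then obtain f where "\<And>n. f n \<in> V" "f \<longlonglongrightarrow> x"
      unfolding closure_sequential by blast
    then show "c *\<^sub>R x \<in> closure V"
      unfolding closure_sequential
      by (intro exI[of _ "\<lambda>n. c *\<^sub>R f n"] conjI allI subspace_scale[OF V] tendsto_scaleR tendsto_const)
  qed
  then show ?thesis
    unfolding sym_proj_tensor_product_def using subspace_span by blast
qed

typedef (overloaded) 'a sym_ptensor =
  "sym_proj_tensor_product :: ('a::real_normed_vector, 'a) bilform_dual set"
  using subspace_0[OF subspace_sym_proj_tensor_product] by blast

setup_lifting type_definition_sym_ptensor

instantiation sym_ptensor :: (real_normed_vector) real_normed_vector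
begin

lift_definition zero_sym_ptensor :: "'a sym_ptensor" is 0
  by (rule subspace_0[OF subspace_sym_proj_tensor_product])
lift_definition plus_sym_ptensor :: "'a sym_ptensor \<Rightarrow> 'a sym_ptensor \<Rightarrow> 'a sym_ptensor" is "(+)"
  by (rule subspace_add[OF subspace_sym_proj_tensor_product])
lift_definition minus_sym_ptensor :: "'a sym_ptensor \<Rightarrow> 'a sym_ptensor \<Rightarrow> 'a sym_ptensor" is "(-)"
  by (rule subspace_diff[OF subspace_sym_proj_tensor_product])
lift_definition uminus_sym_ptensor :: "'a sym_ptensor \<Rightarrow> 'a sym_ptensor" is uminus
  by (rule subspace_neg[OF subspace_sym_proj_tensor_product])
lift_definition scaleR_sym_ptensor :: "real \<Rightarrow> 'a sym_ptensor \<Rightarrow> 'a sym_ptensor" is scaleR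
  by (rule subspace_scale[OF subspace_sym_proj_tensor_product])
lift_definition norm_sym_ptensor :: "'a sym_ptensor \<Rightarrow> real" is norm .

definition dist_sym_ptensor :: "'a sym_ptensor \<Rightarrow> 'a sym_ptensor \<Rightarrow> real"
  where "dist_sym_ptensor x y = norm (x - y)"
definition sgn_sym_ptensor :: "'a sym_ptensor \<Rightarrow> 'a sym_ptensor"
  where "sgn_sym_ptensor x = inverse (norm x) *\<^sub>R x"
definition uniformity_sym_ptensor :: "('a sym_ptensor \<times> 'a sym_ptensor) filter"
  where "uniformity_sym_ptensor = (INF e\<in>{0<..}. principal {(x, y). dist x y < e})"
definition open_sym_ptensor :: "'a sym_ptensor set \<Rightarrow> bool"
  where "open_sym_ptensor U \<longleftrightarrow> (\<forall>x\<in>U. \<forall>\<^sub>F (x', y) in uniformity. x' = x \<longrightarrow> y \<in> U)"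

instance
proof
  fix x y z :: "'a sym_ptensor" and a b :: real
  show "x + y + z = x + (y + z)" by transfer (simp add: add.assoc)
  show "x + y = y + x" by transfer (simp add: add.commute)
  show "0 + x = x" by transfer simp
  show "- x + x = 0" by transfer simp
  show "x - y = x + - y" by transfer simp
  show "a *\<^sub>R (x + y) = a *\<^sub>R x + a *\<^sub>R y" by transfer (simp add: scaleR_add_right)
  show "(a + b) *\<^sub>R x = a *\<^sub>R x + b *\<^sub>R x" by transfer (simp add: scaleR_add_left)
  show "a *\<^sub>R b *\<^sub>R x = (a * b) *\<^sub>R x" by transfer simp
  show "1 *\<^sub>R x = x" by transfer simp
  show "dist x y = norm (x - y)" by (rule dist_sym_ptensor_def)
  show "sgn x = inverse (norm x) *\<^sub>R x" by (rule sgn_sym_ptensor_def)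
  show "(uniformity :: ('a sym_ptensor \<times> 'a sym_ptensor) filter)
      = (INF e\<in>{0<..}. principal {(x, y). dist x y < e})"
    by (rule uniformity_sym_ptensor_def)
  show "open U \<longleftrightarrow> (\<forall>x\<in>U. \<forall>\<^sub>F (x', y) in uniformity. x' = x \<longrightarrow> y \<in> U)" for U :: "'a sym_ptensor set"
    by (rule open_sym_ptensor_def)
  show "norm x = 0 \<longleftrightarrow> x = 0" by transfer simp
  show "norm (x + y) \<le> norm x + norm y" by transfer (rule norm_triangle_ineq)
  show "norm (a *\<^sub>R x) = \<bar>a\<bar> * norm x" by transfer simp
qed

end

lift_definition tensor_square :: "'a::real_normed_vector \<Rightarrow> 'a sym_ptensor" is "\<lambda>u. u \<otimes>\<^sub>\<pi> u"
  unfolding sym_proj_tensor_product_def by (blast intro: span_base closure_subset[THEN subsetD])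


section \<open>Dilinear mappings and diconvex functionals\<close>

definition bounded_dilinear :: "('a::real_normed_vector \<Rightarrow> 'b::real_normed_vector) \<Rightarrow> bool" where
  "bounded_dilinear K \<longleftrightarrow>
    (\<exists>Kb :: 'a \<times> 'a sym_ptensor \<Rightarrow> 'b. bounded_linear Kb \<and> (\<forall>u. K u = Kb (u, tensor_square u)))"

definition proper_functional :: "('a \<Rightarrow> ereal) \<Rightarrow> bool" where
  "proper_functional F \<longleftrightarrow> (\<forall>x. F x \<noteq> -\<infinity>) \<and> (\<exists>x. F x \<noteq> \<infinity>)"

definition convex_functional :: "('a::real_vector \<Rightarrow> ereal) \<Rightarrow> bool" where
  "convex_functional F \<longleftrightarrow>
    (\<forall>x y. \<forall>t\<in>{0<..<1}. F ((1 - t) *\<^sub>R x + t *\<^sub>R y) \<le> ereal (1 - t) * F x + ereal t * F y)"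

definition diconvex :: "('a::real_normed_vector \<Rightarrow> ereal) \<Rightarrow> bool" where
  "diconvex F \<longleftrightarrow>
    (\<exists>Fb :: 'a \<times> 'a sym_ptensor \<Rightarrow> ereal. proper_functional Fb \<and> convex_functional Fb \<and>
      (\<forall>u. F u = Fb (u, tensor_square u)))"


section \<open>Preduals and weak* topologies\<close>

text \<open>
  A predual of \<open>'a\<close> is a Banach space \<open>'p\<close> with an isometric isomorphism \<open>J\<close> of \<open>'a\<close> onto the
  dual space of \<open>'p\<close>. On that dual space the strong operator topology is the topology of
  pointwise convergence, that is, the weak* topology.
\<close>

definition is_predual :: "('a::real_normed_vector \<Rightarrow> ('p::real_normed_vector \<Rightarrow>\<^sub>L real)) \<Rightarrow> bool" where
  "is_predual J \<longleftrightarrow> linear J \<and> surj J \<and> (\<forall>u. norm (J u) = norm u)"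

definition weak_star :: "('a \<Rightarrow> ('p::real_normed_vector \<Rightarrow>\<^sub>L real)) \<Rightarrow> 'a topology" where
  "weak_star J = pullback_topology UNIV J strong_operator_topology"

definition reflexive_space :: "'p::real_normed_vector itself \<Rightarrow> bool" where
  "reflexive_space _ \<longleftrightarrow>
    (\<forall>\<psi> :: ('p \<Rightarrow>\<^sub>L real) \<Rightarrow>\<^sub>L real. \<exists>x :: 'p. \<forall>\<phi>. blinfun_apply \<psi> \<phi> = blinfun_apply \<phi> x)"

definition seq_lsc :: "'a topology \<Rightarrow> ('a \<Rightarrow> ereal) \<Rightarrow> bool" where
  "seq_lsc T F \<longleftrightarrow>
    (\<forall>x l. limitin T x l sequentially \<longrightarrow> F l \<le> liminf (\<lambda>n. F (x n)))"

definition seq_continuous :: "'a topology \<Rightarrow> 'b topology \<Rightarrow> ('a \<Rightarrow> 'b) \<Rightarrow> bool" where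
  "seq_continuous S T f \<longleftrightarrow>
    (\<forall>x l. limitin S x l sequentially \<longrightarrow> limitin T (\<lambda>n. f (x n)) (f l) sequentially)"


section \<open>Tikhonov regularization\<close>

definition tikhonov ::
  "('a \<Rightarrow> 'b::real_normed_vector) \<Rightarrow> ('a \<Rightarrow> ereal) \<Rightarrow> real \<Rightarrow> real \<Rightarrow> 'b \<Rightarrow> 'a \<Rightarrow> ereal" where
  "tikhonov K R p \<alpha> g u = ereal (norm (K u - g) powr p) + ereal \<alpha> * R u"

definition minimizing_solution ::
  "('a \<Rightarrow> 'b) \<Rightarrow> ('a \<Rightarrow> ereal) \<Rightarrow> 'b \<Rightarrow> 'a \<Rightarrow> bool" where
  "minimizing_solution K R g u \<longleftrightarrow> K u = g \<and> (\<forall>v. K v = g \<longrightarrow> R u \<le> R v)"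

definition H_property :: "('a::real_normed_vector) topology \<Rightarrow> ('a \<Rightarrow> ereal) \<Rightarrow> bool" where
  "H_property T R \<longleftrightarrow>
    (\<forall>x l. limitin T x l sequentially \<longrightarrow> (\<lambda>n. R (x n)) \<longlonglongrightarrow> R l \<longrightarrow> x \<longlonglongrightarrow> l)"

end

theory Submission
  imports Defs "HOL-Library.Diagonal_Subsequence"
begin

text \<open>
  Comparing a minimizer with any solution \<open>v\<close> of the exact problem bounds its residual by
  \<open>\<delta>\<^sup>p + \<alpha> R v\<close> and its penalty by \<open>\<delta>\<^sup>p / \<alpha> + R v\<close>. Hence the residuals vanish, coercivity bounds
  the minimizers in norm, and every weak* limit of a subsequence is an \<open>R\<close>-minimizing solution
  at which the penalties converge.

  For weak* sequential compactness of bounded sequences \<open>\<phi>\<close> in the dual of \<open>P\<close>, it suffices to find a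
  countable \<open>A \<subseteq> P\<close> whose span approximates each point of \<open>P\<close> uniformly with respect to all \<open>\<phi> n\<close>.
  If \<open>P\<close> is reflexive, let \<open>A\<close> norm a countable dense subset of the span of \<open>\<phi>\<close>: a functional
  dominated by \<open>sup\<^sub>n \<bar>\<phi> n\<bar>\<close> lies in the closed span of \<open>\<phi>\<close> by reflexivity, so it vanishes if it
  vanishes on \<open>A\<close>, and Hahn-Banach yields the approximation.
\<close>

section \<open>Hahn-Banach functionals and the distance to a subspace\<close>

text \<open>The distance \<open>q\<close> to \<open>W\<close>, measured by \<open>s\<close>, is
  itself sublinear. It lies below \<open>s\<close>, is zero on \<open>W\<close> and is at least
  \<open>e\<close> at \<open>x\<close>, so a linear functional below \<open>q\<close> that touches
  it at \<open>x\<close> has all the required properties.\<close>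

lemma sublinear_distance_functional:
  fixes s :: "'v::real_vector \<Rightarrow> real"
  assumes s: "sublinear s" and s_nonneg: "\<And>y. 0 \<le> s y" and W: "subspace W"
    and far: "\<And>w. w \<in> W \<Longrightarrow> e \<le> s (x - w)"
  obtains f where "linear f" "\<And>y. f y \<le> s y" "\<And>w. w \<in> W \<Longrightarrow> f w = 0" "e \<le> f x"
proof -
  define q where "q = (\<lambda>y. INF w\<in>W. s (y - w))"
  have ne: "W \<noteq> {}" using subspace_0[OF W] by blast
  have bdd: "bdd_below ((\<lambda>w. s (y - w)) ` W)" for y
    by (rule bdd_belowI2[where m = 0]) (rule s_nonneg)
  have q_le: "q y \<le> s (y - w)" if "w \<in> W" for y w
    unfolding q_def by (rule cINF_lower[OF bdd that])
  have q_ge: "m \<le> q y" if "\<And>w. w \<in> W \<Longrightarrow> m \<le> s (y - w)" for m y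
    unfolding q_def by (rule cINF_greatest[OF ne that])
  have add: "q (a + b) \<le> q a + q b" for a b
  proof -
    have 1: "q (a + b) \<le> s (a - v) + s (b - w)" if "v \<in> W" "w \<in> W" for v w
      using q_le[OF subspace_add[OF W that], of "a + b"] sublinearD(1)[OF s, of "a - v" "b - w"]
      by (simp add: algebra_simps)
    \<comment> \<open>The infimum is taken over \<open>w\<close> first and over \<open>v\<close>
      afterwards.\<close>
    have "q (a + b) - s (a - v) \<le> q b" if "v \<in> W" for v
      using 1[OF that] by (intro q_ge) (simp add: algebra_simps)
    then have "q (a + b) - q b \<le> q a"
      by (intro q_ge) (simp add: algebra_simps)
    then show ?thesis by simp
  qed
  have hom_le: "q (c *\<^sub>R y) \<le> c * q y" if "c > 0" for c y
  proof -
    have "q (c *\<^sub>R y) / c \<le> q y"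
    proof (rule q_ge)
      fix w assume "w \<in> W"
      then have "q (c *\<^sub>R y) \<le> s (c *\<^sub>R (y - w))"
        using q_le[OF subspace_scale[OF W], of w "c *\<^sub>R y" c] by (simp add: algebra_simps)
      then show "q (c *\<^sub>R y) / c \<le> s (y - w)"
        using sublinearD(2)[OF s, of c "y - w"] that by (simp add: field_simps)
    qed
    then show ?thesis using that by (simp add: field_simps)
  qed
  have W0: "q w = 0" if "w \<in> W" for w
    using q_le[OF that, of w] q_ge[of 0 w] s_nonneg sublinearD(3)[OF s] by fastforce
  have hom: "q (c *\<^sub>R y) = c * q y" if "c \<ge> 0" for c y
  proof (cases "c = 0")
    case True
    then show ?thesis using W0[OF subspace_0[OF W]] by simp
  next
    case False
    then have c: "c > 0" using that by simp
    \<comment> \<open>The reverse inequality is \<open>hom_le\<close> for the inverse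
      factor.\<close>
    have "q (inverse c *\<^sub>R c *\<^sub>R y) \<le> inverse c * q (c *\<^sub>R y)" using c by (intro hom_le) simp
    then have "c * q y \<le> q (c *\<^sub>R y)" using c by (simp add: field_simps)
    then show ?thesis using hom_le[OF c, of y] by simp
  qed
  have "sublinear q" using add hom by (simp add: sublinear_def)
  then obtain f where f: "linear f" "\<And>y. f y \<le> q y" "f x = q x"
    using sublinear_dominates_linear by blast
  show ?thesis
  proof
    show "linear f" by fact
    show "f y \<le> s y" for y
      using f(2)[of y] q_le[OF subspace_0[OF W], of y] by simp
    show "f w = 0" if "w \<in> W" for w
      \<comment> \<open>Since \<open>q\<close> is zero at both \<open>w\<close> and
        \<open>- w\<close>, the bound by \<open>q\<close> holds \<open>f w\<close> at 0 from both
        sides.\<close>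
      using f(2)[of w] f(2)[of "- w"] W0[OF that] W0[OF subspace_neg[OF W that]]
        linear_neg[OF f(1), of w] by simp
    show "e \<le> f x" unfolding f(3) using far by (rule q_ge)
  qed
qed

lemma linear_abs_le:
  fixes f :: "'v::real_vector \<Rightarrow> real"
  assumes "linear f" "\<And>y. f y \<le> s y" "\<And>y. s (- y) = s y"
  shows "\<bar>f y\<bar> \<le> s y"
  using assms(2)[of y] assms(2)[of "- y"] assms(3)[of y] linear_neg[OF assms(1), of y] by simp

lemma sublinear_norm: "sublinear norm"
  by (simp add: sublinear_def norm_triangle_ineq)

section \<open>Countable dense sets and norming vectors\<close>

text \<open>Rational coefficients suffice. Coding the combinations as lists over a countable type
  makes their range countable at once.\<close>

lemma countable_dense_in_span:
  fixes \<phi> :: "nat \<Rightarrow> 'v::real_normed_vector"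
  obtains D where "countable D" "span (range \<phi>) \<subseteq> closure D"
proof
  define comb where
    "comb = (\<lambda>l :: (rat \<times> nat) list. \<Sum>(q, k)\<leftarrow>l. of_rat q *\<^sub>R \<phi> k)"
  show "countable (range comb)" by simp
  show "span (range \<phi>) \<subseteq> closure (range comb)"
  proof
    fix v assume "v \<in> span (range \<phi>)"
    then show "v \<in> closure (range comb)"
    proof (induction rule: span_induct_alt)
      case base
      have "comb [] = 0" by (simp add: comb_def)
      then show ?case using closure_subset by (metis rangeI subsetD)
    next
      case (step c b y)
      then obtain k where k: "b = \<phi> k" by blast
      show ?case
        unfolding closure_approachable
      proof (intro allI impI)
        fix e :: real assume e: "0 < e"
        obtain l where l: "dist (comb l) y < e / 2"
          using step.IH e unfolding closure_approachable by (metis half_gt_zero rangeE)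
        \<comment> \<open>Moving the coefficient of \<open>b\<close> by less than \<open>h\<close>
          costs at most \<open>e / 2\<close>; the summand 1 covers \<open>b = 0\<close>.\<close>
        define h where "h = e / 2 / (norm b + 1)"
        have nb: "norm b + 1 > 0" by (simp add: add_nonneg_pos)
        have h: "h > 0" using e nb by (simp add: h_def)
        obtain q where q: "c < of_rat q" "of_rat q < c + h"
          using of_rat_dense[of c "c + h"] h by auto
        have "norm ((of_rat q - c) *\<^sub>R b) \<le> h * (norm b + 1)"
          unfolding norm_scaleR using q by (intro mult_mono) auto
        moreover have "h * (norm b + 1) = e / 2"
          unfolding h_def using nb by (intro nonzero_divide_eq_eq[THEN iffD1, symmetric]) auto
        ultimately have 2: "norm ((of_rat q - c) *\<^sub>R b) \<le> e / 2" by simp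
        have step_eq: "comb ((q, k) # l) - (c *\<^sub>R b + y) = (of_rat q - c) *\<^sub>R b + (comb l - y)"
          by (simp add: comb_def k algebra_simps)
        have "dist (comb ((q, k) # l)) (c *\<^sub>R b + y) < e"
          using norm_triangle_ineq[of "(of_rat q - c) *\<^sub>R b" "comb l - y"] 2 l
          unfolding dist_norm step_eq by linarith
        then show "\<exists>y'\<in>range comb. dist y' (c *\<^sub>R b + y) < e" by blast
      qed
    qed
  qed
qed

text \<open>The norm of \<open>d\<close> need not be attained on the unit ball, but half of it
  always is: otherwise half of the norm would already be an operator bound for
  \<open>d\<close>.\<close>

lemma blinfun_norming_vector:
  fixes d :: "'p::real_normed_vector \<Rightarrow>\<^sub>L real"
  obtains x where "norm x \<le> 1" "norm d / 2 \<le> d x"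
proof (cases "d = 0")
  case True
  then show ?thesis using that[of 0] by simp
next
  case False
  then have pos: "norm d > 0" by simp
  have "\<exists>y. norm d / 2 * norm y < \<bar>d y\<bar>"
  proof (rule ccontr)
    assume "\<not> ?thesis"
    then have "norm d \<le> norm d / 2" by (intro norm_blinfun_bound) (auto simp: not_less)
    then show False using pos by simp
  qed
  then obtain y where y: "norm d / 2 * norm y < \<bar>d y\<bar>" by blast
  then have ny: "norm y > 0" by (cases "y = 0") auto
  \<comment> \<open>The sign makes the value positive, and the division normalizes
    \<open>y\<close>.\<close>
  define x where "x = (sgn (d y) / norm y) *\<^sub>R y"
  have "norm x \<le> 1" using ny by (simp add: x_def abs_sgn_eq)
  moreover have "norm d / 2 \<le> d x"
    using y ny by (simp add: x_def blinfun.scaleR_right field_simps abs_sgn)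
  ultimately show ?thesis by (rule that)
qed

section \<open>Weak* convergence and sequential compactness\<close>

lemma limitin_weak_star:
  "limitin (weak_star J) x l F \<longleftrightarrow> (\<forall>p. ((\<lambda>n. blinfun_apply (J (x n)) p) \<longlongrightarrow> blinfun_apply (J l) p) F)"
  (is "?L \<longleftrightarrow> ?R")
proof
  assume lim: ?L
  show ?R
  proof
    fix p
    have "continuous_map (weak_star J) euclidean ((\<lambda>f. blinfun_apply f p) \<circ> J)"
      unfolding weak_star_def
      by (intro continuous_map_pullback strong_operator_topology_continuous_evaluation)
    from continuous_map_limit[OF this lim]
    show "((\<lambda>n. blinfun_apply (J (x n)) p) \<longlongrightarrow> blinfun_apply (J l) p) F"
      by (simp add: o_def)
  qed
next
  assume R: ?R
  \<comment> \<open>The strong operator topology is pulled back along \<open>blinfun_apply\<close>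
    from the product topology on functions, where limits are taken componentwise.\<close>
  have "limitin euclidean (\<lambda>n. blinfun_apply (J (x n))) (blinfun_apply (J l)) F"
    unfolding euclidean_product_topology[symmetric]
    using R by (simp add: limitin_componentwise)
  then show ?L
    unfolding weak_star_def strong_operator_topology_def limitin_def
      topspace_pullback_topology openin_pullback_topology
    by (auto dest: topological_tendstoD)
qed

text \<open>A diagonal subsequence converges on \<open>A\<close>, and by linearity on its span. As
  one approximant serves all functionals at once, the values at any point form a Cauchy sequence;
  the bound \<open>M\<close> passes to the limit.\<close>

lemma bounded_pointwise_convergent_subsequence:
  fixes \<phi> :: "nat \<Rightarrow> ('p::real_normed_vector \<Rightarrow>\<^sub>L real)"
  assumes bound: "\<And>n. norm (\<phi> n) \<le> M" and A: "countable A"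
    and approx: "\<And>x e. e > 0 \<Longrightarrow> \<exists>y\<in>span A. \<forall>n. \<bar>\<phi> n (x - y)\<bar> \<le> e"
  obtains r l where "strict_mono (r :: nat \<Rightarrow> nat)" "\<And>x. (\<lambda>n. \<phi> (r n) x) \<longlonglongrightarrow> blinfun_apply l x"
proof -
  have app: "\<bar>\<phi> n x\<bar> \<le> M * norm x" for n x
    using norm_blinfun[of "\<phi> n" x] mult_right_mono[OF bound[of n] norm_ge_zero[of x]] by simp
  \<comment> \<open>Values outside \<open>A\<close> can arise only if \<open>A\<close> is empty.
    They are harmless, since the selection below works for every vector.\<close>
  define a where "a = from_nat_into A"
  define P where "P = (\<lambda>k s. convergent (\<lambda>n. \<phi> (s n) (a k)))"
  interpret subseqs P
  proof
    fix k and s :: "nat \<Rightarrow> nat"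
    have "bounded (range (\<lambda>n. \<phi> (s n) (a k)))"
      unfolding bounded_iff using app by (intro exI[of _ "M * norm (a k)"]) auto
    then obtain r' l where "strict_mono r'" "((\<lambda>n. \<phi> (s n) (a k)) \<circ> r') \<longlonglongrightarrow> l"
      using bounded_imp_convergent_subsequence by blast
    then show "\<exists>r'. strict_mono r' \<and> P k (s \<circ> r')"
      unfolding P_def convergent_def o_def by blast
  qed
  define \<psi> where "\<psi> = (\<lambda>n. \<phi> (diagseq n))"
  have on_a: "convergent (\<lambda>n. \<psi> n (a k))" for k
  proof -
    \<comment> \<open>Only from index \<open>Suc k\<close> on is the diagonal sequence a subsequence
      of the one selected for \<open>a k\<close>; an initial segment does not affect
      convergence.\<close>
    have "P k (diagseq \<circ> ((+) (Suc k)))"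
      by (rule diagseq_holds) (use convergent_subseq_convergent in \<open>fastforce simp: P_def o_def\<close>)
    then have "convergent (\<lambda>n. \<psi> (n + Suc k) (a k))"
      by (simp add: P_def \<psi>_def o_def add.commute)
    then show ?thesis
      using convergent_ignore_initial_segment[of "\<lambda>n. \<psi> n (a k)" "Suc k"] by blast
  qed
  have on_span: "convergent (\<lambda>n. \<psi> n y)" if "y \<in> span A" for y
    using that
  proof (induction rule: span_induct_alt)
    case base
    show ?case by (simp add: convergent_const)
  next
    case (step c b y)
    then obtain k where "b = a k" using A from_nat_into_surj unfolding a_def by metis
    then show ?case
      using on_a[of k] step.IH
      by (auto simp: blinfun.add_right blinfun.scaleR_right intro!: convergent_add convergent_mult convergent_const)
  qed
  have conv: "convergent (\<lambda>n. \<psi> n x)" for x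
    unfolding Cauchy_convergent_iff[symmetric]
  proof (rule metric_CauchyI)
    fix e :: real assume e: "0 < e"
    obtain y where y: "y \<in> span A" "\<And>n. \<bar>\<phi> n (x - y)\<bar> \<le> e / 4"
      using approx[of "e / 4" x] e by auto
    obtain N where N: "\<And>m n. m \<ge> N \<Longrightarrow> n \<ge> N \<Longrightarrow> dist (\<psi> m y) (\<psi> n y) < e / 4"
      using metric_CauchyD[OF convergent_Cauchy[OF on_span[OF y(1)]], of "e / 4"] e by auto
    have "dist (\<psi> m x) (\<psi> n x) < e" if "m \<ge> N" "n \<ge> N" for m n
    proof -
      have "\<bar>\<psi> m x - \<psi> m y\<bar> \<le> e / 4" "\<bar>\<psi> n x - \<psi> n y\<bar> \<le> e / 4"
        using y(2) by (simp_all add: \<psi>_def blinfun.diff_right)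
      then show ?thesis using N[OF that] unfolding dist_real_def by linarith
    qed
    then show "\<exists>N. \<forall>m\<ge>N. \<forall>n\<ge>N. dist (\<psi> m x) (\<psi> n x) < e" by blast
  qed
  define L where "L = (\<lambda>x. lim (\<lambda>n. \<psi> n x))"
  have L: "(\<lambda>n. \<psi> n x) \<longlonglongrightarrow> L x" for x
    unfolding L_def using conv convergent_LIMSEQ_iff by blast
  have "bounded_linear L"
  proof (rule bounded_linear_intro[where K = M])
    show "L (x + y) = L x + L y" for x y
      using tendsto_add[OF L[of x] L[of y]] L[of "x + y"]
      by (simp add: blinfun.add_right LIMSEQ_unique)
    show "L (c *\<^sub>R x) = c *\<^sub>R L x" for c x
      using tendsto_scaleR[OF tendsto_const L[of x], of c] L[of "c *\<^sub>R x"]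
      by (simp add: blinfun.scaleR_right LIMSEQ_unique)
    show "norm (L x) \<le> norm x * M" for x
      using app by (intro tendsto_upperbound[OF tendsto_norm[OF L[of x]]])
        (auto simp: \<psi>_def mult.commute)
  qed
  then have "(\<lambda>n. \<phi> (diagseq n) x) \<longlonglongrightarrow> blinfun_apply (Blinfun L) x" for x
    using L by (simp add: bounded_linear_Blinfun_apply \<psi>_def)
  then show ?thesis by (rule that[OF subseq_diagseq])
qed

lemma reflexive_countable_approximation:
  fixes \<phi> :: "nat \<Rightarrow> ('p::real_normed_vector \<Rightarrow>\<^sub>L real)"
  assumes refl: "reflexive_space TYPE('p)" and bound: "\<And>n. norm (\<phi> n) \<le> M"
  obtains A where "countable A" "\<And>x e. e > 0 \<Longrightarrow> \<exists>y\<in>span A. \<forall>n. \<bar>\<phi> n (x - y)\<bar> \<le> e"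
proof -
  obtain D where D: "countable D" "span (range \<phi>) \<subseteq> closure D"
    using countable_dense_in_span by blast
  have "\<exists>x. norm x \<le> 1 \<and> norm d / 2 \<le> d x" for d :: "'p \<Rightarrow>\<^sub>L real"
    using blinfun_norming_vector by metis
  then obtain z where z: "\<And>d :: 'p \<Rightarrow>\<^sub>L real. norm (z d) \<le> 1" "\<And>d. norm d / 2 \<le> blinfun_apply d (z d)"
    by metis
  define A where "A = z ` D"
  have app: "\<bar>\<phi> n y\<bar> \<le> M * norm y" for n y
    using norm_blinfun[of "\<phi> n" y] mult_right_mono[OF bound[of n] norm_ge_zero[of y]] by simp
  \<comment> \<open>The supremum is finite by \<open>bound\<close>, and the claim says that
    \<open>span A\<close> is dense for the seminorm \<open>s\<close>.\<close>
  define s where "s = (\<lambda>y. SUP n. \<bar>\<phi> n y\<bar>)"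
  have bdd: "bdd_above (range (\<lambda>n. \<bar>\<phi> n y\<bar>))" for y
    by (rule bdd_aboveI2) (rule app)
  have s_ge: "\<bar>\<phi> n y\<bar> \<le> s y" for n y
    unfolding s_def by (rule cSUP_upper[OF UNIV_I bdd])
  have s_le: "s y \<le> m" if "\<And>n. \<bar>\<phi> n y\<bar> \<le> m" for y m
    unfolding s_def by (rule cSUP_least) (use that in auto)
  have s_nonneg: "0 \<le> s y" for y using s_ge[of 0 y] by simp
  have s_scale_le: "s (c *\<^sub>R y) \<le> \<bar>c\<bar> * s y" for c y
    by (rule s_le) (simp add: blinfun.scaleR_right abs_mult mult_left_mono s_ge)
  have s_sub: "sublinear s"
    unfolding sublinear_def
  proof (intro conjI allI impI)
    fix x y
    show "s (x + y) \<le> s x + s y"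
      using s_ge[of _ x] s_ge[of _ y]
      by (intro s_le) (force simp: blinfun.add_right intro: order_trans[OF abs_triangle_ineq add_mono])
  next
    fix x and c :: real assume c: "0 \<le> c"
    show "s (c *\<^sub>R x) = c * s x"
    proof (cases "c = 0")
      case True
      then show ?thesis using s_scale_le[of 0 x] s_nonneg[of 0] by simp
    next
      case False
      then have "s x \<le> inverse c * s (c *\<^sub>R x)" using s_scale_le[of "inverse c" "c *\<^sub>R x"] c by simp
      then show ?thesis using False c s_scale_le[of c x] by (simp add: field_simps)
    qed
  qed
  show ?thesis
  proof
    show "countable A" using D(1) by (simp add: A_def)
    fix x and e :: real assume e: "e > 0"
    show "\<exists>y\<in>span A. \<forall>n. \<bar>\<phi> n (x - y)\<bar> \<le> e"
    proof (rule ccontr)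
      assume no: "\<not> ?thesis"
      have far: "e \<le> s (x - w)" if "w \<in> span A" for w
        using no that s_ge[of _ "x - w"] by (meson linear order_trans)
      \<comment> \<open>A failure of density yields a functional that is zero on
        \<open>span A\<close> but not at \<open>x\<close>. The rest shows that it is zero
        everywhere.\<close>
      obtain f where f: "linear f" "\<And>y. f y \<le> s y" "\<And>w. w \<in> span A \<Longrightarrow> f w = 0" "e \<le> f x"
        using sublinear_distance_functional[OF s_sub s_nonneg subspace_span far] by blast
      have f_abs: "\<bar>f y\<bar> \<le> s y" for y
        by (rule linear_abs_le[OF f(1,2)]) (simp add: s_def blinfun.minus_right)
      have "bounded_linear f"
      proof (rule bounded_linear_intro[where K = M])
        show "norm (f y) \<le> norm y * M" for y
          using f_abs[of y] s_le[of y "M * norm y"] app by (simp add: mult.commute)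
      qed (simp_all add: linear_add[OF f(1)] linear_scale[OF f(1)])
      then have F: "blinfun_apply (Blinfun f) y = f y" for y by (simp add: bounded_linear_Blinfun_apply)
      have near: "\<exists>d\<in>D. norm (Blinfun f - d) < \<eta>" if \<eta>: "\<eta> > 0" for \<eta>
      proof -
        have "\<exists>v\<in>span (range \<phi>). norm (Blinfun f - v) < \<eta> / 2"
        proof (rule ccontr)
          assume "\<not> ?thesis"
          then have "\<eta> / 2 \<le> norm (Blinfun f - v)" if "v \<in> span (range \<phi>)" for v
            using that by force
          then obtain h where h: "linear h" "\<And>y. h y \<le> norm y"
            "\<And>w. w \<in> span (range \<phi>) \<Longrightarrow> h w = 0" "\<eta> / 2 \<le> h (Blinfun f)"
            using sublinear_distance_functional[OF sublinear_norm norm_ge_zero subspace_span] by blast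
          have "\<bar>h y\<bar> \<le> norm y" for y by (rule linear_abs_le[OF h(1,2)]) simp
          then have "bounded_linear h"
            by (intro bounded_linear_intro[where K = 1])
              (simp_all add: linear_add[OF h(1)] linear_scale[OF h(1)])
          then obtain y where y: "\<And>\<psi>. h \<psi> = blinfun_apply \<psi> y"
            using refl unfolding reflexive_space_def by (metis bounded_linear_Blinfun_apply)
          \<comment> \<open>The seminorm \<open>s\<close> sees \<open>y\<close> only through the
            \<phi> n, so a vector annihilated by all of them has \<open>s y = 0\<close>. Domination
            by \<open>s\<close> then makes \<open>f\<close> vanish at \<open>y\<close>, against the
            separation by \<open>h\<close>.\<close>
          have "\<phi> n y = 0" for n using h(3)[of "\<phi> n"] y by (simp add: span_base)
          then have "s y \<le> 0" by (intro s_le) simp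
          then have "h (Blinfun f) = 0" using f_abs[of y] y F by simp
          then show False using h(4) \<eta> by simp
        qed
        then obtain v where v: "v \<in> closure D" "norm (Blinfun f - v) < \<eta> / 2" using D(2) by blast
        then obtain d where "d \<in> D" "norm (d - v) < \<eta> / 2"
          unfolding closure_approachable dist_norm using \<eta> by (meson half_gt_zero)
        then show ?thesis
          using norm_triangle_ineq4[of "Blinfun f - v" "d - v"] v(2) by (intro bexI[of _ d]) auto
      qed
      \<comment> \<open>As \<open>f\<close> vanishes at \<open>z d\<close>, the value of
        \<open>d\<close> there is at most the distance \<eta> from \<open>d\<close> to
        \<open>f\<close>. The choice of \<open>z\<close> gives \<open>norm d\<close> at most 2
        \<eta>, and a further \<eta> leads from \<open>d\<close> to \<open>f\<close>.\<close>
      have bound_f: "norm (Blinfun f) \<le> 3 * \<eta>" if \<eta>: "\<eta> > 0" for \<eta>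
      proof -
        obtain d where d: "d \<in> D" "norm (Blinfun f - d) < \<eta>" using near[OF \<eta>] by blast
        have "f (z d) = 0" using d(1) by (intro f(3) span_base) (simp add: A_def)
        then have "d (z d) = blinfun_apply (d - Blinfun f) (z d)" by (simp add: F blinfun.diff_left)
        also have "\<dots> \<le> norm (d - Blinfun f) * norm (z d)"
          using norm_blinfun[of "d - Blinfun f" "z d"] by simp
        also have "\<dots> \<le> \<eta> * 1" using d(2) z(1) \<eta> by (intro mult_mono) (auto simp: norm_minus_commute)
        finally have "norm d \<le> 2 * \<eta>" using z(2)[of d] by simp
        then show ?thesis using d(2) norm_triangle_ineq[of "Blinfun f - d" d] by simp
      qed
      have "Blinfun f = 0"
        \<comment> \<open>With this \<eta> the norm would be at most 3/4 of itself.\<close>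
        using bound_f[of "norm (Blinfun f) / 4"] by (cases "Blinfun f = 0") auto
      then have "f x = 0" using F[of x] by simp
      then show False using f(4) e by simp
    qed
  qed
qed

text \<open>A countable dense set works for every bounded sequence, because the common bound
  \<open>M\<close> turns closeness in norm into uniform closeness of the values.\<close>

lemma separable_countable_approximation:
  fixes \<phi> :: "nat \<Rightarrow> ('p::real_normed_vector \<Rightarrow>\<^sub>L real)"
  assumes sep: "separable_space (euclidean :: 'p topology)" and bound: "\<And>n. norm (\<phi> n) \<le> M"
  obtains A where "countable A" "\<And>x e. e > 0 \<Longrightarrow> \<exists>y\<in>span A. \<forall>n. \<bar>\<phi> n (x - y)\<bar> \<le> e"
proof -
  obtain A :: "'p set" where A: "countable A" "closure A = UNIV"
    using sep unfolding separable_space_def by auto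
  have M: "0 \<le> M" using norm_ge_zero bound by (rule order_trans)
  show ?thesis
  proof (rule that[OF A(1)])
    fix x and e :: real assume e: "e > 0"
    have "x \<in> closure A" using A(2) by simp
    \<comment> \<open>The summand 1 avoids a division by zero when \<open>M = 0\<close>.\<close>
    moreover have "e / (M + 1) > 0" using e M by simp
    ultimately obtain y where y: "y \<in> A" "norm (y - x) < e / (M + 1)"
      unfolding closure_approachable dist_norm by blast
    have "\<bar>\<phi> n (x - y)\<bar> \<le> e" for n
    proof -
      have "\<bar>\<phi> n (x - y)\<bar> \<le> norm (\<phi> n) * norm (x - y)" using norm_blinfun[of "\<phi> n" "x - y"] by simp
      also have "\<dots> \<le> (M + 1) * (e / (M + 1))"
        using bound[of n] y(2) M by (intro mult_mono) (auto simp: norm_minus_commute)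
      finally show ?thesis using M by simp
    qed
    then show "\<exists>y\<in>span A. \<forall>n. \<bar>\<phi> n (x - y)\<bar> \<le> e" using span_base[OF y(1)] by blast
  qed
qed

lemma weak_star_sequentially_compact:
  fixes J :: "'a::real_normed_vector \<Rightarrow> ('p::real_normed_vector \<Rightarrow>\<^sub>L real)"
  assumes J: "is_predual J"
    and P: "separable_space (euclidean :: 'p topology) \<or> reflexive_space TYPE('p)"
    and bound: "\<And>n. norm (x n) \<le> M"
  obtains r l where "strict_mono (r :: nat \<Rightarrow> nat)" "limitin (weak_star J) (x \<circ> r) l sequentially"
proof -
  have bd: "norm (J (x n)) \<le> M" for n using J bound by (simp add: is_predual_def)
  obtain A where A: "countable A"
    "\<And>y e. e > 0 \<Longrightarrow> \<exists>z\<in>span A. \<forall>n. \<bar>blinfun_apply (J (x n)) (y - z)\<bar> \<le> e"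
    using P
  proof
    assume "separable_space (euclidean :: 'p topology)"
    from separable_countable_approximation[where \<phi> = "\<lambda>n. J (x n)", OF this bd] that
    show ?thesis by metis
  next
    assume "reflexive_space TYPE('p)"
    from reflexive_countable_approximation[where \<phi> = "\<lambda>n. J (x n)", OF this bd] that
    show ?thesis by metis
  qed
  obtain r \<psi> where r: "strict_mono r" "\<And>y. (\<lambda>n. blinfun_apply (J (x (r n))) y) \<longlonglongrightarrow> blinfun_apply \<psi> y"
    using bounded_pointwise_convergent_subsequence[where \<phi> = "\<lambda>n. J (x n)", OF bd A] by metis
  \<comment> \<open>Surjectivity of \<open>J\<close> carries the limit functional back to a point of
    the original space.\<close>
  obtain l where "J l = \<psi>" using J unfolding is_predual_def surj_def by metis
  then show ?thesis using r by (intro that[of r l]) (auto simp: limitin_weak_star)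
qed

lemma weak_star_limit_unique:
  assumes J: "is_predual J"
    and "limitin (weak_star J) x l F" "limitin (weak_star J) x l' F" "F \<noteq> bot"
  shows "l = l'"
proof -
  have "J l = J l'"
    using assms(2-4) by (intro blinfun_eqI) (auto simp: limitin_weak_star intro: tendsto_unique)
  then have "norm (J (l - l')) = 0"
    using J by (simp add: is_predual_def linear_diff)
  then have "norm (l - l') = 0" using J unfolding is_predual_def by metis
  then show ?thesis by simp
qed

lemma weak_star_limit_if_norm_limit:
  assumes J: "is_predual J" and x: "(x \<longlongrightarrow> l) F"
  shows "limitin (weak_star J) x l F"
proof -
  have "norm (J (x n) - J l) = norm (x n - l)" for n
    using J by (simp add: is_predual_def linear_diff[symmetric])
  then have "((\<lambda>n. J (x n)) \<longlongrightarrow> J l) F"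
    using x unfolding tendsto_iff dist_norm by simp
  then show ?thesis
    unfolding limitin_weak_star by (intro allI tendsto_intros)
qed

text \<open>If convergence failed at some \<open>y\<close>, a subsequence would keep its values at
  \<open>y\<close> a fixed distance away from the limit, and so would all its further
  subsequences.\<close>

lemma weak_star_limit_if_all_subsequences:
  fixes J :: "'a::real_normed_vector \<Rightarrow> ('p::real_normed_vector \<Rightarrow>\<^sub>L real)"
  assumes sub: "\<And>s. strict_mono (s :: nat \<Rightarrow> nat) \<Longrightarrow>
    \<exists>r. strict_mono r \<and> limitin (weak_star J) (x \<circ> s \<circ> r) l sequentially"
  shows "limitin (weak_star J) x l sequentially"
  unfolding limitin_weak_star
proof (rule allI, rule ccontr)
  fix y
  let ?X = "\<lambda>n. blinfun_apply (J (x n)) y"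
  assume "\<not> ?X \<longlonglongrightarrow> blinfun_apply (J l) y"
  then obtain e where e: "e > 0" "\<not> (\<forall>\<^sub>F n in sequentially. dist (?X n) (blinfun_apply (J l) y) < e)"
    unfolding tendsto_iff by blast
  obtain s :: "nat \<Rightarrow> nat" where s: "strict_mono s" "\<forall>n. \<not> dist (?X (s n)) (blinfun_apply (J l) y) < e"
    using not_eventually_sequentiallyD[OF e(2)] by auto
  obtain r where "strict_mono r" "limitin (weak_star J) (x \<circ> s \<circ> r) l sequentially"
    using sub[OF s(1)] by blast
  then have "(\<lambda>n. ?X (s (r n))) \<longlonglongrightarrow> blinfun_apply (J l) y"
    by (simp add: limitin_weak_star)
  then have "\<forall>\<^sub>F n in sequentially. dist (?X (s (r n))) (blinfun_apply (J l) y) < e"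
    using e(1) unfolding tendsto_iff by blast
  then show False using s(2) by simp
qed

section \<open>Convergence of the Tikhonov minimizers\<close>

theorem theorem4p15:
  fixes JX :: "'a::banach \<Rightarrow> ('p::banach \<Rightarrow>\<^sub>L real)"
    and JY :: "'b::banach \<Rightarrow> ('q::banach \<Rightarrow>\<^sub>L real)"
    and K :: "'a \<Rightarrow> 'b"
    and R :: "'a \<Rightarrow> ereal"
    and p :: real
    and \<alpha> :: "real \<Rightarrow> real"
    and gdag :: 'b
    and g :: "nat \<Rightarrow> 'b"
    and u :: "nat \<Rightarrow> 'a"
  defines "\<delta> \<equiv> \<lambda>n. norm (gdag - g n)"
  assumes preduals: "is_predual JX" "is_predual JY"
    and predual_X: "separable_space (euclidean :: 'p topology) \<or> reflexive_space TYPE('p)"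
    and K_dilinear: "bounded_dilinear K"
    and R_nonneg: "\<And>v. 0 \<le> R v"
    and R_proper: "proper_functional R"
    and R_diconvex: "diconvex R"
    and p_ge_1: "1 \<le> p"
    and coercive: "\<And>a h. 0 < a \<Longrightarrow> (tikhonov K R p a h \<longlongrightarrow> \<infinity>) at_infinity"
    and R_lsc: "seq_lsc (weak_star JX) R"
    and K_cont: "seq_continuous (weak_star JX) (weak_star JY) K"
    and exact_data: "\<exists>v. K v = gdag \<and> R v < \<infinity>"
    and noise: "\<delta> \<longlonglongrightarrow> 0"
    and alpha_pos: "\<And>n. 0 < \<alpha> (\<delta> n)"
    and alpha_rate: "(\<lambda>n. \<delta> n powr p / \<alpha> (\<delta> n)) \<longlonglongrightarrow> 0"
    and alpha_lim: "(\<lambda>n. \<alpha> (\<delta> n)) \<longlonglongrightarrow> 0"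
    and minimizer: "\<And>n v. tikhonov K R p (\<alpha> (\<delta> n)) (g n) (u n) \<le> tikhonov K R p (\<alpha> (\<delta> n)) (g n) v"
  shows
    "(\<exists>r udag. strict_mono r \<and> minimizing_solution K R gdag udag \<and>
        limitin (weak_star JX) (u \<circ> r) udag sequentially)
     \<and> (\<forall>udag. minimizing_solution K R gdag udag \<and> (\<forall>v. minimizing_solution K R gdag v \<longrightarrow> v = udag) \<longrightarrow>
          limitin (weak_star JX) u udag sequentially)
     \<and> (H_property (weak_star JX) R \<longrightarrow>
          (\<forall>r l. strict_mono r \<and> limitin (weak_star JX) (u \<circ> r) l sequentially \<longrightarrow> (u \<circ> r) \<longlonglongrightarrow> l)
          \<and> (\<forall>udag. minimizing_solution K R gdag udag \<and>
                (\<forall>v. minimizing_solution K R gdag v \<longrightarrow> v = udag) \<longrightarrow> u \<longlonglongrightarrow> udag))"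
proof -

  \<comment> \<open>A priori estimates from minimality\<close>
  define c where "c = (\<lambda>n. \<alpha> (\<delta> n))"
  have c_pos: "0 < c n" for n using alpha_pos by (simp add: c_def)
  have c_lim: "c \<longlonglongrightarrow> 0" using alpha_lim by (simp add: c_def)
  have rate: "(\<lambda>n. \<delta> n powr p / c n) \<longlonglongrightarrow> 0" using alpha_rate by (simp add: c_def)
  have p: "0 < p" using p_ge_1 by simp
  have compare: "ereal (norm (K (u n) - g n) powr p) + ereal (c n) * R (u n)
      \<le> ereal (\<delta> n powr p) + ereal (c n) * R v" if "K v = gdag" for n v
    using minimizer[of n v] that by (simp add: tikhonov_def c_def \<delta>_def)
  \<comment> \<open>This solution of finite penalty is the reference competitor. Comparison with it
    makes every \<open>R (u n)\<close> finite, so the estimates can be carried out in the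
    reals.\<close>
  obtain v0 where v0: "K v0 = gdag" "R v0 < \<infinity>" using exact_data by blast
  obtain r0 where r0: "R v0 = ereal r0" using v0(2) R_nonneg[of v0] by (cases "R v0") auto
  define \<rho> where "\<rho> = (\<lambda>n. real_of_ereal (R (u n)))"
  have R_u: "R (u n) = ereal (\<rho> n)" for n
    using compare[OF v0(1), of n] R_nonneg[of "u n"] c_pos[of n]
    by (cases "R (u n)") (auto simp: \<rho>_def r0)
  have \<rho>_nonneg: "0 \<le> \<rho> n" for n using R_nonneg[of "u n"] by (simp add: R_u)
  have compare_real: "norm (K (u n) - g n) powr p + c n * \<rho> n \<le> \<delta> n powr p + c n * \<rho>'"
    if "K v = gdag" "R v = ereal \<rho>'" for n v \<rho>'
    using compare[OF that(1), of n] by (simp add: R_u that(2))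
  have \<rho>_le: "\<rho> n \<le> \<delta> n powr p / c n + \<rho>'" if "K v = gdag" "R v = ereal \<rho>'" for n v \<rho>'
  proof -
    have "c n * \<rho> n \<le> \<delta> n powr p + c n * \<rho>'"
      using compare_real[OF that, of n] powr_ge_zero[of "norm (K (u n) - g n)" p] by linarith
    then show ?thesis using c_pos[of n] by (simp add: field_simps)
  qed
  have \<delta>_nonneg: "0 \<le> \<delta> n" for n by (simp add: \<delta>_def)
  have residual: "(\<lambda>n. norm (K (u n) - g n)) \<longlonglongrightarrow> 0"
  proof -
    have upper: "(\<lambda>n. \<delta> n powr p + c n * r0) \<longlonglongrightarrow> 0 + 0 * r0"
      using noise c_lim p \<delta>_nonneg by (intro tendsto_intros tendsto_zero_powrI[of _ _ _ p]) auto
    have "(\<lambda>n. norm (K (u n) - g n) powr p) \<longlonglongrightarrow> 0"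
    proof (rule tendsto_sandwich[OF _ _ tendsto_const])
      show "(\<lambda>n. \<delta> n powr p + c n * r0) \<longlonglongrightarrow> 0" using upper by simp
      show "\<forall>\<^sub>F n in sequentially. norm (K (u n) - g n) powr p \<le> \<delta> n powr p + c n * r0"
        using compare_real[OF v0(1) r0] c_pos \<rho>_nonneg
        by (intro always_eventually allI) (smt (verit) mult_nonneg_nonneg)
    qed simp
    \<comment> \<open>Taking the p-th root recovers the residual itself.\<close>
    then have "(\<lambda>n. (norm (K (u n) - g n) powr p) powr (1 / p)) \<longlonglongrightarrow> 0"
      by (rule tendsto_zero_powrI[OF _ tendsto_const]) (use p in auto)
    then show ?thesis using p by (simp add: powr_powr)
  qed
  have K_u: "(\<lambda>n. K (u n)) \<longlonglongrightarrow> gdag"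
  proof -
    have lim: "(\<lambda>n. norm (K (u n) - g n) + \<delta> n) \<longlonglongrightarrow> 0"
      using tendsto_add[OF residual noise] by simp
    have "\<forall>n. norm (K (u n) - gdag) \<le> norm (K (u n) - g n) + \<delta> n"
      using norm_triangle_ineq4[of "K (u n) - g n" "gdag - g n" for n] by (simp add: \<delta>_def)
    then have "(\<lambda>n. K (u n) - gdag) \<longlonglongrightarrow> 0"
      by (rule Lim_null_comparison[OF always_eventually lim])
    then show ?thesis by (simp add: LIM_zero_iff)
  qed
  obtain M where M: "\<And>n. norm (u n) \<le> M"
  proof -
    have "bounded (range (\<lambda>n. K (u n) - gdag))"
      using K_u by (intro convergent_imp_bounded[where l = 0]) (simp add: LIM_zero_iff)
    then obtain C1 where C1: "\<And>n. norm (K (u n) - gdag) \<le> C1"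
      unfolding bounded_iff by blast
    obtain C2 where C2: "\<And>n. \<bar>\<delta> n powr p / c n\<bar> \<le> C2"
      using convergent_imp_bounded[OF rate] unfolding bounded_iff by auto
    \<comment> \<open>Coercivity is used for one fixed functional, with weight 1 and data
      \<open>gdag\<close>. The constant \<open>C\<close> bounds its values at all minimizers:
      \<open>C1\<close> controls the residuals, \<open>C2 + r0\<close> the penalties.\<close>
    define C where "C = C1 powr p + (C2 + r0)"
    have "\<forall>\<^sub>F x in at_infinity. ereal C < tikhonov K R p 1 gdag x"
      using order_tendstoD(1)[OF coercive[of 1 gdag], of "ereal C"] by simp
    then obtain b where b: "\<And>x. b \<le> norm x \<Longrightarrow> ereal C < tikhonov K R p 1 gdag x"
      unfolding eventually_at_infinity by blast
    have "norm (u n) \<le> b" for n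
    proof (rule ccontr)
      assume "\<not> ?thesis"
      then have "ereal C < tikhonov K R p 1 gdag (u n)" by (intro b) simp
      then have "C < norm (K (u n) - gdag) powr p + \<rho> n"
        by (simp add: tikhonov_def R_u)
      moreover have "norm (K (u n) - gdag) powr p \<le> C1 powr p"
        using C1 p by (intro powr_mono2) auto
      moreover have "\<rho> n \<le> C2 + r0"
        using \<rho>_le[OF v0(1) r0, of n] C2[of n] by linarith
      ultimately show False by (simp add: C_def)
    qed
    then show ?thesis by (rule that)
  qed

  \<comment> \<open>Weak* limits of subsequences\<close>
  have limits: "minimizing_solution K R gdag l \<and> (\<lambda>n. R (u (r n))) \<longlonglongrightarrow> R l"
    if r: "strict_mono r" and lim: "limitin (weak_star JX) (u \<circ> r) l sequentially"
    for r :: "nat \<Rightarrow> nat" and l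
  proof -
    have "limitin (weak_star JY) (\<lambda>n. K (u (r n))) (K l) sequentially"
      using K_cont lim unfolding seq_continuous_def by fastforce
    moreover have "limitin (weak_star JY) (\<lambda>n. K (u (r n))) gdag sequentially"
      using LIMSEQ_subseq_LIMSEQ[OF K_u r]
      by (intro weak_star_limit_if_norm_limit preduals(2)) (simp add: o_def)
    \<comment> \<open>Norm convergence to \<open>gdag\<close> implies weak* convergence, so
      uniqueness of weak* limits identifies \<open>K l\<close>.\<close>
    ultimately have Kl: "K l = gdag"
      by (rule weak_star_limit_unique[OF preduals(2)]) simp
    have lsc: "R l \<le> liminf (\<lambda>n. R (u (r n)))"
      using R_lsc lim unfolding seq_lsc_def by fastforce
    \<comment> \<open>The estimate holds for every solution \<open>v\<close>: it gives minimality of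
      \<open>l\<close>, and for \<open>v = l\<close> it closes the chain from \<open>R l\<close>
      through liminf and limsup back to \<open>R l\<close>. It is trivial if \<open>R v\<close> is
      infinite.\<close>
    have limsup: "limsup (\<lambda>n. R (u (r n))) \<le> R v" if v: "K v = gdag" for v
    proof (cases "R v")
      case (real \<rho>')
      have "(\<lambda>n. \<delta> (r n) powr p / c (r n) + \<rho>') \<longlonglongrightarrow> 0 + \<rho>'"
        using LIMSEQ_subseq_LIMSEQ[OF rate r] by (intro tendsto_intros) (simp add: o_def)
      then have "(\<lambda>n. ereal (\<delta> (r n) powr p / c (r n) + \<rho>')) \<longlonglongrightarrow> R v"
        by (simp add: real)
      then have "limsup (\<lambda>n. ereal (\<delta> (r n) powr p / c (r n) + \<rho>')) = R v"
        by (intro lim_imp_Limsup) simp_all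
      moreover have "limsup (\<lambda>n. R (u (r n))) \<le> limsup (\<lambda>n. ereal (\<delta> (r n) powr p / c (r n) + \<rho>'))"
        using \<rho>_le[OF v real] by (intro Limsup_mono always_eventually) (simp add: R_u)
      ultimately show ?thesis by simp
    qed (use R_nonneg[of v] in auto)
    have lim_le: "liminf (\<lambda>n. R (u (r n))) \<le> limsup (\<lambda>n. R (u (r n)))"
      by (intro Liminf_le_Limsup) simp
    have "minimizing_solution K R gdag l"
      unfolding minimizing_solution_def using Kl lsc lim_le limsup by (blast intro: order_trans)
    moreover have "(\<lambda>n. R (u (r n))) \<longlonglongrightarrow> R l"
      using lsc lim_le limsup[OF Kl] by (subst tendsto_iff_Liminf_eq_Limsup) (auto intro: antisym)
    ultimately show ?thesis by blast
  qed

  \<comment> \<open>The three assertions\<close>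
  \<comment> \<open>Stated for arbitrary subsequences, this gives (a) with \<open>s\<close> the
    identity, and (b) by the subsequence principle, as uniqueness forces a common limit.\<close>
  have subseq: "\<exists>r l. strict_mono r \<and> minimizing_solution K R gdag l \<and>
      limitin (weak_star JX) (u \<circ> s \<circ> r) l sequentially" if s: "strict_mono s" for s :: "nat \<Rightarrow> nat"
  proof -
    obtain r l where r: "strict_mono (r :: nat \<Rightarrow> nat)" "limitin (weak_star JX) (u \<circ> s \<circ> r) l sequentially"
      using weak_star_sequentially_compact[where x = "u \<circ> s" and M = M, OF preduals(1) predual_X] M
      by (metis comp_apply)
    then show ?thesis
      using limits[OF strict_mono_o[OF s r(1)]] by (auto simp: o_assoc)
  qed
  have whole: "limitin (weak_star JX) u udag sequentially"
    if "\<And>v. minimizing_solution K R gdag v \<Longrightarrow> v = udag" for udag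
    by (rule weak_star_limit_if_all_subsequences) (use subseq that in blast)
  \<comment> \<open>The convergence of the penalties that the H-property requires is the second half
    of \<open>limits\<close>.\<close>
  have strong: "(u \<circ> r) \<longlonglongrightarrow> l"
    if "H_property (weak_star JX) R" "strict_mono r" "limitin (weak_star JX) (u \<circ> r) l sequentially"
    for r :: "nat \<Rightarrow> nat" and l
    using that limits[OF that(2,3)] unfolding H_property_def by (auto simp: o_def)
  have strong_whole: "u \<longlonglongrightarrow> udag"
    if "H_property (weak_star JX) R" "\<And>v. minimizing_solution K R gdag v \<Longrightarrow> v = udag" for udag
    using strong[OF that(1) strict_mono_id, of udag] whole[OF that(2)] by simp
  show ?thesis
  proof (intro conjI allI impI)
    show "\<exists>r udag. strict_mono r \<and> minimizing_solution K R gdag udag \<and>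
        limitin (weak_star JX) (u \<circ> r) udag sequentially"
      using subseq[OF strict_mono_id] by auto
  qed (use whole strong strong_whole in blast)+
qed

end
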